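(* Let $b\in\omega$ with $b\geq 2$. There exists a coloring (i.e. a map) $c:C^{\uparrow}_{\mathrm{sur}}(b^\omega)\to\omega$ such that for every $h\in C^{\uparrow}_{\mathrm{sur}}(b^\omega)$ the set $\{f\circ h:f\in C^{\uparrow}_{\mathrm{sur}}(b^\omega)\}$ witnesses all the colors, that is, for every $r\in\omega$ there exists $f\in C^{\uparrow}_{\mathrm{sur}}(b^\omega)$ with $c(f\circ h)=r$.
   Context: $\omega=\{0,1,2,\dots\}$. $b^\omega$ is the set of infinite sequences with values in $\{0,\dots,b-1\}$, with the metric $\rho_b(x,y)=2^{-n_0}$, $n_0=\min\{n:x(n)\neq y(n)\}$, for $x\ne y$. The lexicographic linear order is: $x\leq_{\mathrm{lex}}y$ iff $x=y$ or $x(n_0)<y(n_0)$ with $n_0=\min\{n:x(n)\neq y(n)\}$. $C^{\uparrow}_{\mathrm{sur}}(b^\omega)$ is the set of all maps $f:b^\omega\to b^\omega$ that are continuous, onto and nondecreasing ($x\leq_{\mathrm{lex}}y$ implies $f(x)\leq_{\mathrm{lex}}f(y)$). *)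

theory Defs
  imports "HOL-Analysis.Analysis" "HOL-Library.FuncSet"
begin

definition seqs :: "nat \<Rightarrow> (nat \<Rightarrow> nat) set" where
  "seqs b = (UNIV \<rightarrow> {..<b})"

definition first_diff :: "(nat \<Rightarrow> nat) \<Rightarrow> (nat \<Rightarrow> nat) \<Rightarrow> nat" where
  "first_diff x y = (LEAST n. x n \<noteq> y n)"

definition seq_dist :: "(nat \<Rightarrow> nat) \<Rightarrow> (nat \<Rightarrow> nat) \<Rightarrow> real" where
  "seq_dist x y = (if x = y then 0 else 1 / 2 ^ first_diff x y)"

definition lex_le :: "(nat \<Rightarrow> nat) \<Rightarrow> (nat \<Rightarrow> nat) \<Rightarrow> bool" where
  "lex_le x y \<longleftrightarrow> x = y \<or> x (first_diff x y) < y (first_diff x y)"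

lemma first_diff_neq: "x \<noteq> y \<Longrightarrow> x (first_diff x y) \<noteq> y (first_diff x y)"
  unfolding first_diff_def by (rule LeastI_ex) auto

lemma first_diff_eq: "n < first_diff x y \<Longrightarrow> x n = y n"
  unfolding first_diff_def using not_less_Least by blast

lemma first_diff_commute: "first_diff x y = first_diff y x"
  unfolding first_diff_def by (simp add: eq_commute)

lemma first_diff_triangle:
  assumes "x \<noteq> z"
  shows "first_diff x y \<le> first_diff x z \<or> first_diff y z \<le> first_diff x z"
  by (metis assms first_diff_eq first_diff_neq not_le)

lemma Metric_space_seqs: "Metric_space (seqs b) seq_dist"
proof
  show "0 \<le> seq_dist x y" for x y
    by (simp add: seq_dist_def)
  show "seq_dist x y = seq_dist y x" for x y
    by (simp add: seq_dist_def first_diff_commute)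
  show "seq_dist x y = 0 \<longleftrightarrow> x = y" for x y
    by (simp add: seq_dist_def)
  show "seq_dist x z \<le> seq_dist x y + seq_dist y z" for x y z
  proof (cases "x = y \<or> y = z \<or> x = z")
    case True
    then show ?thesis by (auto simp: seq_dist_def)
  next
    case False
    have "1 / 2 ^ n \<le> (1 / 2 ^ m + 1 / 2 ^ k :: real)" if "m \<le> n \<or> k \<le> n" for m n k :: nat
    proof -
      have "1 / 2 ^ n \<le> (1 / 2 ^ m :: real) \<or> 1 / 2 ^ n \<le> (1 / 2 ^ k :: real)"
        using that by (auto simp: field_simps)
      moreover have "(0::real) \<le> 1 / 2 ^ m" "(0::real) \<le> 1 / 2 ^ k"
        by simp_all
      ultimately show ?thesis by linarith
    qed
    with False first_diff_triangle[of x z y]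
    show ?thesis by (auto simp: seq_dist_def)
  qed
qed

abbreviation seq_topology :: "nat \<Rightarrow> (nat \<Rightarrow> nat) topology" where
  "seq_topology b \<equiv> Metric_space.mtopology (seqs b) seq_dist"

text \<open>
  Maps between sequence spaces are represented by functions that are \<^const>\<open>undefined\<close> outside
  \<^term>\<open>seqs b\<close>, so that equality of HOL functions is equality of maps.
\<close>

definition C_sur_up :: "nat \<Rightarrow> ((nat \<Rightarrow> nat) \<Rightarrow> (nat \<Rightarrow> nat)) set" where
  "C_sur_up b = {f \<in> seqs b \<rightarrow>\<^sub>E seqs b.
     continuous_map (seq_topology b) (seq_topology b) f \<and>
     f ` seqs b = seqs b \<and>
     monotone_on (seqs b) lex_le lex_le f}"

lemma compose_in_C_sur_up:
  assumes "f \<in> C_sur_up b" "h \<in> C_sur_up b"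
  shows "compose (seqs b) f h \<in> C_sur_up b"
proof -
  have top: "topspace (seq_topology b) = seqs b"
    by (simp add: Metric_space.topspace_mtopology[OF Metric_space_seqs])
  have h: "h x \<in> seqs b" if "x \<in> seqs b" for x
    using assms(2) that by (auto simp: C_sur_up_def)
  have "continuous_map (seq_topology b) (seq_topology b) (f \<circ> h)"
    using assms by (auto simp: C_sur_up_def intro: continuous_map_compose)
  then have "continuous_map (seq_topology b) (seq_topology b) (compose (seqs b) f h)"
    by (rule continuous_map_eq) (simp add: top compose_def)
  moreover have "compose (seqs b) f h ` seqs b = seqs b"
    using assms by (intro surj_compose) (auto simp: C_sur_up_def)
  moreover have "monotone_on (seqs b) lex_le lex_le (compose (seqs b) f h)"
    using assms h by (auto simp: C_sur_up_def monotone_on_def compose_def)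
  moreover have "compose (seqs b) f h \<in> seqs b \<rightarrow>\<^sub>E seqs b"
    using assms h by (auto simp: C_sur_up_def compose_def)
  ultimately show ?thesis by (simp add: C_sur_up_def)
qed

end

theory Submission
  imports Defs
begin

text \<open>
  No structure of the colouring is required, so a Bernstein-type transfinite choice suffices. As
  every \<open>h\<close> is onto, \<open>f \<mapsto> f \<circ> h\<close> is injective, so \<open>{f \<circ> h}\<close> has the cardinality \<open>\<kappa>\<close> of the whole
  monoid \<open>S\<close>. Since \<open>\<kappa>\<close> is infinite, there are only \<open>\<kappa>\<close> pairs \<open>(h, r)\<close>; well-order them
  in type \<open>\<kappa>\<close> and choose successively pairwise distinct members of \<open>{f \<circ> h}\<close> to receive
  the colour \<open>r\<close>.
\<close>

unbundle cardinal_syntax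

text \<open>\<open>|I|\<close> is a well-order of \<open>I\<close> of least possible type, so its
  proper initial segments have cardinality strictly below \<open>|I|\<close>. The values already
  chosen therefore never exhaust \<open>A i\<close>, and the recursion always finds a new
  one.\<close>

lemma ex_injective_choice:
  assumes "\<And>i. i \<in> I \<Longrightarrow> |I| \<le>o |A i|"
  shows "\<exists>g. inj_on g I \<and> (\<forall>i\<in>I. g i \<in> A i)"
proof -
  let ?r = "|I|"
  have wo: "well_order_on I ?r" and fld: "Field ?r = I"
    using card_of_well_order_on[of I] by (simp_all only: Field_card_of)
  then have wf: "wf (?r - Id)"
    by (simp add: well_order_on_def)
  define G where "G = (\<lambda>g i. SOME a. a \<in> A i - g ` underS ?r i)"
  define g where "g = wfrec (?r - Id) G"
  \<comment> \<open>Admissibility of the recursion: \<open>G\<close> consults \<open>g\<close> only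
    at strict predecessors of \<open>i\<close>, where \<open>cut\<close> changes nothing.\<close>
  have "G (cut g (?r - Id) i) i = G g i" for i
  proof -
    have "cut g (?r - Id) i ` underS ?r i = g ` underS ?r i"
      by (rule image_cong) (auto simp: cut_def underS_def)
    then show ?thesis by (simp add: G_def)
  qed
  then have g_eq: "g i = (SOME a. a \<in> A i - g ` underS ?r i)" for i
    using wfrec[OF wf, of G i] by (simp add: g_def G_def)
  have g_in: "g i \<in> A i - g ` underS ?r i" if "i \<in> I" for i
  proof -
    have "|underS ?r i| <o |I|"
      using that fld by (intro card_of_underS) (simp_all only: card_of_card_order_on)
    then have "|g ` underS ?r i| <o |A i|"
      using assms[OF that] card_of_image ordLeq_ordLess_trans ordLess_ordLeq_trans by blast
    then have "\<not> A i \<subseteq> g ` underS ?r i"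
      using card_of_mono1 not_ordLess_ordLeq by blast
    then have "\<exists>a. a \<in> A i - g ` underS ?r i" by blast
    then show ?thesis unfolding g_eq[of i] by (rule someI_ex)
  qed
  have "inj_on g I"
  proof (rule inj_onI, rule ccontr)
    fix i j assume ij: "i \<in> I" "j \<in> I" "g i = g j" "i \<noteq> j"
    \<comment> \<open>By totality one index precedes the other, and the later choice avoided the
      earlier value.\<close>
    then have "i \<in> underS ?r j \<or> j \<in> underS ?r i"
      using wo fld unfolding well_order_on_def linear_order_on_def total_on_def underS_def by auto
    with ij g_in show False by (metis DiffD2 imageI)
  qed
  with g_in show ?thesis by blast
qed

lemma seq_dist_less_iff: "seq_dist x y < 1 / 2 ^ k \<longleftrightarrow> (\<forall>i\<le>k. x i = y i)"
proof (cases "x = y")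
  case False
  have "seq_dist x y < 1 / 2 ^ k \<longleftrightarrow> k < first_diff x y"
    using False by (simp add: seq_dist_def field_simps)
  also have "\<dots> \<longleftrightarrow> (\<forall>i\<le>k. x i = y i)"
    using first_diff_neq[OF False] first_diff_eq[of _ x y] by (metis leI le_less_trans)
  finally show ?thesis .
qed (simp add: seq_dist_def)

lemma lex_le_iff: "lex_le x y \<longleftrightarrow> x = y \<or> (\<exists>n. (\<forall>i<n. x i = y i) \<and> x n < y n)"
proof -
  have "first_diff x y = n" if "\<forall>i<n. x i = y i" "x n < y n" for n
    unfolding first_diff_def using that by (intro Least_equality) (auto intro: leI)
  then show ?thesis
    unfolding lex_le_def using first_diff_eq[of _ x y] by blast
qed

lemma lex_le_zero: "lex_le (\<lambda>_. 0) y"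
proof (cases "y = (\<lambda>_. 0)")
  case False
  then show ?thesis
    using first_diff_neq[of "\<lambda>_. 0" y] by (auto simp: lex_le_def)
qed (simp add: lex_le_def)

text \<open>A family of members of the monoid, indexed by \<open>n\<close>, that shows it to be
  infinite. Sequences beginning with \<open>n\<close> top digits form a final segment of the order;
  it is stretched onto the whole space, and everything below it collapses to the least
  sequence.\<close>

definition zoom :: "nat \<Rightarrow> nat \<Rightarrow> (nat \<Rightarrow> nat) \<Rightarrow> (nat \<Rightarrow> nat)" where
  "zoom b n = restrict (\<lambda>x. if \<forall>i<n. x i = b - 1 then \<lambda>k. x (k + n) else (\<lambda>_. 0)) (seqs b)"

lemma zoom_apply:
  "x \<in> seqs b \<Longrightarrow> zoom b n x k = (if \<forall>i<n. x i = b - 1 then x (k + n) else 0)"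
  by (simp only: zoom_def restrict_apply' if_distribR)

lemma zoom_in_seqs: "b \<ge> 2 \<Longrightarrow> x \<in> seqs b \<Longrightarrow> zoom b n x \<in> seqs b"
  by (simp add: seqs_def zoom_apply[unfolded seqs_def] Pi_iff)

lemma continuous_map_zoom:
  assumes "b \<ge> 2"
  shows "continuous_map (seq_topology b) (seq_topology b) (zoom b n)"
  unfolding Metric_space.metric_continuous_map[OF Metric_space_seqs Metric_space_seqs]
proof (intro conjI ballI allI impI)
  show "zoom b n ` seqs b \<subseteq> seqs b"
    using assms zoom_in_seqs by blast
next
  fix x and \<epsilon> :: real assume x: "x \<in> seqs b" and "\<epsilon> > 0"
  then obtain k where k: "1 / 2 ^ k < \<epsilon>"
    using real_arch_pow_inv[of \<epsilon> "1 / 2"] by (auto simp: power_one_over)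
  show "\<exists>\<delta>>0. \<forall>y. y \<in> seqs b \<and> seq_dist x y < \<delta> \<longrightarrow> seq_dist (zoom b n x) (zoom b n y) < \<epsilon>"
  proof (intro exI conjI allI impI)
    \<comment> \<open>Agreement up to \<open>k + n\<close> settles both the test on the first
      \<open>n\<close> digits and, after the shift by \<open>n\<close>, the output digits up to
      \<open>k\<close>.\<close>
    fix y assume y: "y \<in> seqs b \<and> seq_dist x y < 1 / 2 ^ (k + n)"
    then have eq: "x i = y i" if "i \<le> k + n" for i
      using that by (simp only: seq_dist_less_iff)
    then have pre: "(\<forall>i<n. x i = b - 1) \<longleftrightarrow> (\<forall>i<n. y i = b - 1)" by auto
    have "zoom b n x i = zoom b n y i" if "i \<le> k" for i
    proof -
      have "x (i + n) = y (i + n)" using that by (intro eq) simp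
      then show ?thesis unfolding zoom_apply[OF x] zoom_apply[OF conjunct1[OF y]] pre by (simp only:)
    qed
    then have "seq_dist (zoom b n x) (zoom b n y) < 1 / 2 ^ k" by (subst seq_dist_less_iff) blast
    with k show "seq_dist (zoom b n x) (zoom b n y) < \<epsilon>" by linarith
  qed simp
qed

lemma zoom_surj:
  assumes "b \<ge> 2"
  shows "zoom b n ` seqs b = seqs b"
proof
  show "zoom b n ` seqs b \<subseteq> seqs b" using assms zoom_in_seqs by blast
  show "seqs b \<subseteq> zoom b n ` seqs b"
  proof
    fix y assume y: "y \<in> seqs b"
    let ?x = "\<lambda>i. if i < n then b - 1 else y (i - n)"
    have x: "?x \<in> seqs b" using y assms by (auto simp: seqs_def)
    then have "zoom b n ?x = y" by (simp add: zoom_def)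
    with x show "y \<in> zoom b n ` seqs b" by (intro image_eqI) simp_all
  qed
qed

lemma zoom_mono: "monotone_on (seqs b) lex_le lex_le (zoom b n)"
proof (rule monotone_onI)
  fix x y assume x: "x \<in> seqs b" and y: "y \<in> seqs b" and "lex_le x y"
  show "lex_le (zoom b n x) (zoom b n y)"
  proof (cases "x = y \<or> \<not> (\<forall>i<n. x i = b - 1)")
    case True
    then show ?thesis using x lex_le_zero[of "zoom b n y"]
      by (auto simp: lex_le_def zoom_def)
  next
    case False
    then obtain m where m: "\<forall>i<m. x i = y i" "x m < y m" and pre: "\<forall>i<n. x i = b - 1"
      using \<open>lex_le x y\<close> by (auto simp: lex_le_iff)
    \<comment> \<open>Since \<open>x m < y m \<le> b - 1\<close>, the first difference cannot lie in
      the prefix of top digits. So \<open>y\<close> has the same prefix and both sequences are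
      merely shifted.\<close>
    have "y m < b" using y by (auto simp: seqs_def)
    then have "x m \<noteq> b - 1" using m(2) by linarith
    then have "n \<le> m" using pre leI by blast
    then have "\<forall>i<n. y i = b - 1" using m(1) pre by auto
    moreover have "lex_le (\<lambda>k. x (k + n)) (\<lambda>k. y (k + n))"
      unfolding lex_le_iff using m \<open>n \<le> m\<close> by (intro disjI2 exI[of _ "m - n"]) auto
    ultimately show ?thesis using x y pre by (simp add: zoom_def)
  qed
qed

lemma infinite_C_sur_up:
  assumes "b \<ge> 2"
  shows "infinite (C_sur_up b)"
proof -
  have "zoom b n \<in> C_sur_up b" for n
    using assms zoom_in_seqs continuous_map_zoom zoom_surj zoom_mono
    by (auto simp: C_sur_up_def zoom_def)
  moreover have "inj (zoom b)"
  proof (rule linorder_injI)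
    fix n m :: nat assume "n < m"
    \<comment> \<open>After deleting \<open>n < m\<close> digits a top digit still leads; after
      deleting \<open>m\<close> only zeros remain. The two differ because
      \<open>b - 1 > 0\<close>.\<close>
    let ?x = "\<lambda>i. if i < m then b - 1 else 0"
    have "?x \<in> seqs b" using assms by (auto simp: seqs_def)
    then have "zoom b n ?x 0 = b - 1" "zoom b m ?x 0 = 0"
      using \<open>n < m\<close> by (simp_all add: zoom_def)
    then show "zoom b n \<noteq> zoom b m" using assms by auto
  qed
  ultimately show ?thesis
    using infinite_iff_countable_subset by blast
qed

lemma inj_on_compose_C_sur_up:
  assumes "h \<in> C_sur_up b"
  shows "inj_on (\<lambda>f. compose (seqs b) f h) (C_sur_up b)"
proof (rule inj_onI)
  fix f g assume fg: "f \<in> C_sur_up b" "g \<in> C_sur_up b"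
    and eq: "compose (seqs b) f h = compose (seqs b) g h"
  show "f = g"
  proof (rule PiE_ext)
    show "f \<in> seqs b \<rightarrow>\<^sub>E seqs b" "g \<in> seqs b \<rightarrow>\<^sub>E seqs b"
      using fg by (simp_all add: C_sur_up_def)
  next
    fix y assume "y \<in> seqs b"
    then have "y \<in> h ` seqs b"
      using assms by (simp add: C_sur_up_def)
    then obtain x where "x \<in> seqs b" "y = h x" by (rule imageE)
    then show "f y = g y" using fun_cong[OF eq, of x] by (simp only: compose_eq)
  qed
qed

theorem corollary14:
  fixes b :: nat
  assumes "b \<ge> 2"
  shows "\<exists>c :: ((nat \<Rightarrow> nat) \<Rightarrow> (nat \<Rightarrow> nat)) \<Rightarrow> nat.
    \<forall>h \<in> C_sur_up b. \<forall>r :: nat. \<exists>f \<in> C_sur_up b. c (compose (seqs b) f h) = r"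
proof -
  let ?S = "C_sur_up b"
  let ?I = "?S \<times> (UNIV :: nat set)"
  \<comment> \<open>The same candidates are offered for every colour \<open>r\<close>; injectivity
    of the choice keeps the colours apart.\<close>
  let ?A = "\<lambda>(h, r :: nat). (\<lambda>f. compose (seqs b) f h) ` ?S"
  have inf: "infinite ?S" using infinite_C_sur_up[OF assms] .
  have "|?I| \<le>o |?A i|" if "i \<in> ?I" for i
  proof -
    obtain h r where i: "i = (h, r)" and h: "h \<in> ?S" using \<open>i \<in> ?I\<close> by auto
    have "|?I| \<le>o |?S|"
      using inf by (intro card_of_Times_infinite_simps(1)[THEN ordIso_imp_ordLeq])
        (simp_all add: infinite_iff_card_of_nat[symmetric])
    moreover have "|?S| \<le>o |?A i|"
      using card_of_ordLeqI[OF inj_on_compose_C_sur_up[OF h], of "?A i"] by (auto simp: i)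
    ultimately show ?thesis by (rule ordLeq_transitive)
  qed
  from ex_injective_choice[of ?I ?A, OF this] obtain g
    where inj: "inj_on g ?I" and g: "\<forall>i\<in>?I. g i \<in> ?A i" by auto
  \<comment> \<open>The colouring recovers the pair \<open>(h, r)\<close> from the map chosen for it
    and returns \<open>r\<close>; on maps never chosen its value is arbitrary.\<close>
  have "\<exists>f\<in>?S. (snd \<circ> inv_into ?I g) (compose (seqs b) f h) = r" if "h \<in> ?S" for h r
  proof -
    have i: "(h, r) \<in> ?I" using that by simp
    then obtain f where "f \<in> ?S" "g (h, r) = compose (seqs b) f h" using g by blast
    with inv_into_f_f[OF inj i] show ?thesis by (metis comp_apply snd_conv)
  qed
  then show ?thesis by blast
qed

end
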